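(* For every positive integer $k$, with the language $L=\{F_1,\dots,F_k\}$ of $k$ unary function symbols, the class $\overrightarrow{\mathcal F}_L$ is a Ramsey class. In other words: the class of all finite ordered oriented graphs which are decomposed into $k$ partial mappings is a Ramsey class.
   Context: Let $k$ be a positive integer. $\mathcal F_L$ is the class of all finite structures $\mathbf A=(A,F_{1,\mathbf A},\dots,F_{k,\mathbf A})$ where each $F_{i,\mathbf A}:A\to A$ is a function, such that, putting $E_i=\{(x,F_{i,\mathbf A}(x)) : x\in A,\ F_{i,\mathbf A}(x)\neq x\}$ (the set of arcs of $F_{i,\mathbf A}$; the points with $F_{i,\mathbf A}(x)=x$, called idempotents, encode that the $i$-th partial mapping is undefined at $x$), the sets $E_1,\dots,E_k$ are pairwise disjoint and $(A,E_1\cup\dots\cup E_k)$ is an oriented graph (no loops and no pair of opposite arcs). Such structures represent oriented graphs with all out-degrees at most $k$ together with a decomposition of the arc set into $k$ sets $E_1,\dots,E_k$, each with out-degrees at most $1$ (i.e. each a partial mapping). $\overrightarrow{\mathcal F}_L$ is the class of all structures $\overrightarrow{\mathbf A}$ obtained from a structure $\mathbf A\in\mathcal F_L$ by adding a binary relation $\leq_{\mathbf A}$ which is a linear ordering of $A$. Embedding: a map $f:A\to B$ is an embedding $\overrightarrow{\mathbf A}\to\overrightarrow{\mathbf B}$ if it is an order-preserving injection with $F_{i,\mathbf B}(f(x))=f(F_{i,\mathbf A}(x))$ for every $x\in A$ and $1\le i\le k$. Copies: a copy of $\mathbf A$ in $\mathbf B$ is the image $f(\mathbf A)$ of an embedding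 $f:\mathbf A\to\mathbf B$. $\binom{\mathbf B}{\mathbf A}$ denotes the set of all copies of $\mathbf A$ in $\mathbf B$. Ramsey class: a class $\mathcal C$ of structures with embeddings is a Ramsey class if for all $\mathbf A,\mathbf B\in\mathcal C$ and every positive integer $r$ there exists $\mathbf C\in\mathcal C$ such that for every partition of $\binom{\mathbf C}{\mathbf A}$ into $r$ classes there is $\widetilde{\mathbf B}\in\binom{\mathbf C}{\mathbf B}$ such that $\binom{\widetilde{\mathbf B}}{\mathbf A}$ is contained in one class of the partition. *)

theory Defs
  imports "HOL-Library.FuncSet" "HOL-Library.Disjoint_Sets" "HOL-Library.Infinite_Typeclass"
begin

record 'v fun_structure =
  universe :: "'v set"
  fn :: "nat \<Rightarrow> 'v \<Rightarrow> 'v"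

record 'v ordered_structure = "'v fun_structure" +
  le :: "('v \<times> 'v) set"

definition arcs :: "('v, 'm) fun_structure_scheme \<Rightarrow> nat \<Rightarrow> ('v \<times> 'v) set" where
  "arcs A i = {(x, fn A i x) | x. x \<in> universe A \<and> fn A i x \<noteq> x}"

definition oriented_graph :: "'v set \<Rightarrow> ('v \<times> 'v) set \<Rightarrow> bool" where
  "oriented_graph V E \<longleftrightarrow> E \<subseteq> V \<times> V \<and> irrefl E \<and> asym E"

(* The extensional function spaces fix the values outside the language {1..k} and outside the
   universe to undefined, so that equality of HOL records is equality of structures. *)
definition F_class :: "nat \<Rightarrow> 'v fun_structure set" where
  "F_class k = {A. finite (universe A) \<and>
      fn A \<in> {1..k} \<rightarrow>\<^sub>E (universe A \<rightarrow>\<^sub>E universe A) \<and>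
      disjoint_family_on (arcs A) {1..k} \<and>
      oriented_graph (universe A) (\<Union>i\<in>{1..k}. arcs A i)}"

definition ordered_F_class :: "nat \<Rightarrow> 'v ordered_structure set" where
  "ordered_F_class k = {A. fun_structure.truncate A \<in> F_class k \<and>
      linear_order_on (universe A) (le A)}"

definition embedding ::
    "nat \<Rightarrow> 'v ordered_structure \<Rightarrow> 'w ordered_structure \<Rightarrow> ('v \<Rightarrow> 'w) \<Rightarrow> bool" where
  "embedding k A B f \<longleftrightarrow>
      f \<in> universe A \<rightarrow> universe B \<and>
      inj_on f (universe A) \<and>
      (\<forall>x\<in>universe A. \<forall>y\<in>universe A. (x, y) \<in> le A \<longrightarrow> (f x, f y) \<in> le B) \<and>
      (\<forall>i\<in>{1..k}. \<forall>x\<in>universe A. fn B i (f x) = f (fn A i x))"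

(* The structure f(A), obtained by transporting A along a map f injective on its universe. *)
definition image_structure ::
    "nat \<Rightarrow> ('v \<Rightarrow> 'w) \<Rightarrow> 'v ordered_structure \<Rightarrow> 'w ordered_structure" where
  "image_structure k f A =
     \<lparr> universe = f ` universe A,
       fn = (\<lambda>i\<in>{1..k}. \<lambda>y\<in>f ` universe A. f (fn A i (inv_into (universe A) f y))),
       le = map_prod f f ` le A \<rparr>"

definition copies ::
    "nat \<Rightarrow> 'w ordered_structure \<Rightarrow> 'v ordered_structure \<Rightarrow> 'w ordered_structure set" where
  "copies k B A = {image_structure k f A | f. embedding k A B f}"

(* The Ramsey property of a class K, where cps B A is the set of copies of A in B.
   A partition into r classes is an indexed family P 0, ..., P (r - 1); classes may be empty,
   as they must be when there are fewer than r copies. *)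
definition ramsey_class :: "('s \<Rightarrow> 's \<Rightarrow> 's set) \<Rightarrow> 's set \<Rightarrow> bool" where
  "ramsey_class cps K \<longleftrightarrow>
     (\<forall>A\<in>K. \<forall>B\<in>K. \<forall>r::nat. r > 0 \<longrightarrow>
       (\<exists>C\<in>K. \<forall>P :: nat \<Rightarrow> 's set.
          disjoint_family_on P {..<r} \<and> (\<Union>i<r. P i) = cps C A \<longrightarrow>
          (\<exists>B'\<in>cps C B. \<exists>i<r. cps B' A \<subseteq> P i)))"

end

theory Submission
  imports Defs "HOL-Library.Ramsey" "HOL-Library.Countable"
begin

text \<open>
  The proof is a partite construction. Let \<open>A\<close> and \<open>B\<close> have \<open>a\<close> and \<open>b\<close> points. By Ramsey's theorem
  choose \<open>n\<close> such that every colouring of the \<open>a\<close>-subsets of \<open>{..<n}\<close> has a homogeneous \<open>b\<close>-subset,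
  and start with the disjoint union of copies of \<open>B\<close>, one over each \<open>b\<close>-subset of the parts
  \<open>{..<n}\<close>. For each \<open>a\<close>-subset \<open>S\<close> in turn, let \<open>D\<close> be the union of the copies of \<open>A\<close> over \<open>S\<close>. As
  the functions are unary, \<open>D\<close> is a substructure, and all its relations are pulled back from \<open>A\<close>; so
  in a large fibre power of \<open>D\<close> over \<open>A\<close> the words over the alphabet of copies of \<open>A\<close> in \<open>D\<close> are
  copies of \<open>A\<close>, combinatorial lines are copies of \<open>D\<close>, and the Hales-Jewett theorem yields a copy
  of \<open>D\<close> with all its copies of \<open>A\<close> in one colour. Extending every line to a copy of the whole
  system by free amalgamation, one obtains after all steps a system in which some copy of the first
  one is coloured so that the colour of a copy of \<open>A\<close> depends only on the parts it meets.
\<close>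

section \<open>The Hales-Jewett theorem\<close>

definition words :: "nat \<Rightarrow> 'a set \<Rightarrow> 'a list set" where
  "words n S = {w. length w = n \<and> set w \<subseteq> S}"

text \<open>A combinatorial line is a template in which \<open>None\<close> marks the moving coordinates.\<close>

definition lines :: "nat \<Rightarrow> 'a set \<Rightarrow> 'a option list set" where
  "lines n S = {\<tau>. length \<tau> = n \<and> set \<tau> \<subseteq> insert None (Some ` S) \<and> None \<in> set \<tau>}"

definition fill :: "'a \<Rightarrow> 'a option list \<Rightarrow> 'a list" where
  "fill a \<tau> = map (case_option a (\<lambda>b. b)) \<tau>"

definition mono_line :: "('a list \<Rightarrow> 'c) \<Rightarrow> 'a set \<Rightarrow> 'a option list \<Rightarrow> bool" where
  "mono_line c S \<tau> \<longleftrightarrow> (\<forall>a\<in>S. \<forall>b\<in>S. c (fill a \<tau>) = c (fill b \<tau>))"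

lemma fill_append [simp]: "fill a (\<sigma> @ \<tau>) = fill a \<sigma> @ fill a \<tau>"
  by (simp add: fill_def)

lemma fill_map_Some [simp]: "fill a (map Some w) = w"
  by (simp add: fill_def o_def)

lemma fill_in_words: "\<tau> \<in> lines n S \<Longrightarrow> a \<in> S \<Longrightarrow> fill a \<tau> \<in> words n S"
  by (fastforce simp: lines_def words_def fill_def)

lemma words_mono: "S \<subseteq> T \<Longrightarrow> words n S \<subseteq> words n T"
  by (auto simp: words_def)

lemma lines_mono: "S \<subseteq> T \<Longrightarrow> lines n S \<subseteq> lines n T"
  by (auto simp: lines_def)

lemma words_append: "u \<in> words m S \<Longrightarrow> v \<in> words n S \<Longrightarrow> u @ v \<in> words (m + n) S"
  by (auto simp: words_def)

lemma lines_append: "\<sigma> \<in> lines m S \<Longrightarrow> \<tau> \<in> lines n S \<Longrightarrow> \<sigma> @ \<tau> \<in> lines (m + n) S"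
  by (auto simp: lines_def)

lemma lines_append_word: "\<sigma> \<in> lines m S \<Longrightarrow> w \<in> words n S \<Longrightarrow> \<sigma> @ map Some w \<in> lines (m + n) S"
  by (auto simp: lines_def words_def)

lemma lines_word_append: "w \<in> words m S \<Longrightarrow> \<tau> \<in> lines n S \<Longrightarrow> map Some w @ \<tau> \<in> lines (m + n) S"
  by (auto simp: lines_def words_def)

lemma finite_words: "finite S \<Longrightarrow> finite (words n S)"
  using finite_lists_length_eq[of S n] by (simp add: words_def conj_commute)

lemma finite_lines: "finite S \<Longrightarrow> finite (lines n S)"
  by (rule finite_subset[OF _ finite_words[of "insert None (Some ` S)" n]])
     (auto simp: lines_def words_def)

definition hales_jewett :: "'a set \<Rightarrow> bool" where
  "hales_jewett S \<longleftrightarrow> (\<forall>r. \<exists>n. \<forall>c :: 'a list \<Rightarrow> nat.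
     c \<in> words n S \<rightarrow> {..<r} \<longrightarrow> (\<exists>\<tau>\<in>lines n S. mono_line c S \<tau>))"

text \<open>Colour focusing uses colours that are themselves colourings of prefixes, so any finite
  colour set must be allowed.\<close>

lemma hales_jewett_colours:
  fixes K :: "'c set"
  assumes "hales_jewett S" and "finite K"
  obtains n where "\<And>c. c \<in> words n S \<rightarrow> K \<Longrightarrow> \<exists>\<tau>\<in>lines n S. mono_line c S \<tau>"
proof -
  obtain g :: "'c \<Rightarrow> nat" where g: "bij_betw g K {..<card K}"
    using ex_bij_betw_finite_nat[OF \<open>finite K\<close>] by (auto simp: atLeast0LessThan)
  obtain n where n: "\<And>c :: 'a list \<Rightarrow> nat. c \<in> words n S \<rightarrow> {..<card K} \<Longrightarrow>
      \<exists>\<tau>\<in>lines n S. mono_line c S \<tau>"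
    using assms(1) unfolding hales_jewett_def by meson
  have "\<exists>\<tau>\<in>lines n S. mono_line c S \<tau>" if c: "c \<in> words n S \<rightarrow> K" for c
  proof -
    have "g \<circ> c \<in> words n S \<rightarrow> {..<card K}"
      using c bij_betwE[OF g] by auto
    then obtain \<tau> where \<tau>: "\<tau> \<in> lines n S" "mono_line (g \<circ> c) S \<tau>"
      using n by meson
    have "mono_line c S \<tau>"
      unfolding mono_line_def
    proof (intro ballI)
      fix a b assume ab: "a \<in> S" "b \<in> S"
      have "g (c (fill a \<tau>)) = g (c (fill b \<tau>))"
        using \<tau>(2) ab unfolding mono_line_def o_def by blast
      moreover have "c (fill a \<tau>) \<in> K" "c (fill b \<tau>) \<in> K"
        using ab by (blast intro: Pi_mem[OF c] fill_in_words[OF \<tau>(1)])+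
      ultimately show "c (fill a \<tau>) = c (fill b \<tau>)"
        using bij_betw_imp_inj_on[OF g] by (blast dest: inj_onD)
    qed
    with \<tau>(1) show ?thesis by blast
  qed
  then show thesis using that by blast
qed

text \<open>A set \<open>C\<close> of colours is focused at the word \<open>f\<close> if each colour in \<open>C\<close> is attained on the
  letters of \<open>S\<close> by a line that passes through \<open>f\<close> at the new letter \<open>t\<close>.\<close>

definition focused :: "('a list \<Rightarrow> nat) \<Rightarrow> nat \<Rightarrow> 'a set \<Rightarrow> 'a \<Rightarrow> 'a list \<Rightarrow> nat set \<Rightarrow> bool" where
  "focused c n S t f C \<longleftrightarrow>
     (\<forall>q\<in>C. \<exists>\<tau>\<in>lines n (insert t S). fill t \<tau> = f \<and> (\<forall>a\<in>S. c (fill a \<tau>) = q))"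

text \<open>Induction on \<open>s\<close>. A word is split into prefix and suffix, and a suffix over
  \<open>S\<close> is coloured by the whole colouring it induces on prefixes. A monochromatic line
  \<sigma> of suffixes leaves a colouring \<open>c'\<close> of prefixes alone. If the focus of
  \<open>c'\<close> has a new colour, the old lines continued by \<sigma>, together with the line
  moving only in \<sigma>, show one more colour.\<close>

lemma colour_focusing:
  fixes r s :: nat
  assumes HJ: "hales_jewett S" and "finite S" "S \<noteq> {}"
  shows "\<exists>n. \<forall>c :: 'a list \<Rightarrow> nat. c \<in> words n (insert t S) \<rightarrow> {..<r} \<longrightarrow>
    (\<exists>\<tau>\<in>lines n (insert t S). mono_line c (insert t S) \<tau>) \<or>
    (\<exists>f\<in>words n (insert t S). \<exists>C\<subseteq>{..<r}. card C = s \<and> focused c n S t f C)"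
proof (induction s)
  case 0
  have "[] \<in> words 0 (insert t S)" by (simp add: words_def)
  moreover have "focused c 0 S t [] {}" for c by (simp add: focused_def)
  ultimately show ?case by (metis card.empty empty_subsetI)
next
  case (Suc s)
  let ?T = "insert t S"
  obtain n where n: "\<And>c :: 'a list \<Rightarrow> nat. c \<in> words n ?T \<rightarrow> {..<r} \<Longrightarrow>
    (\<exists>\<tau>\<in>lines n ?T. mono_line c ?T \<tau>) \<or>
    (\<exists>f\<in>words n ?T. \<exists>C\<subseteq>{..<r}. card C = s \<and> focused c n S t f C)"
    using Suc by blast
  have "finite (words n ?T \<rightarrow>\<^sub>E {..<r})"
    using \<open>finite S\<close> by (intro finite_PiE finite_words) auto
  from hales_jewett_colours[OF HJ this] obtain m where m:
    "\<And>c. c \<in> words m S \<rightarrow> (words n ?T \<rightarrow>\<^sub>E {..<r}) \<Longrightarrow> \<exists>\<tau>\<in>lines m S. mono_line c S \<tau>"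
    by blast
  obtain a0 where a0: "a0 \<in> S" using \<open>S \<noteq> {}\<close> by blast
  show ?case
  proof (intro exI[of _ "n + m"] allI impI)
    fix c :: "'a list \<Rightarrow> nat"
    assume c: "c \<in> words (n + m) ?T \<rightarrow> {..<r}"
    have "(\<lambda>v. \<lambda>u\<in>words n ?T. c (u @ v)) \<in> words m S \<rightarrow> (words n ?T \<rightarrow>\<^sub>E {..<r})"
      using c words_append[of _ n ?T _ m] words_mono[of S ?T m] by fastforce
    from m[OF this] obtain \<sigma> where \<sigma>: "\<sigma> \<in> lines m S"
      and "mono_line (\<lambda>v. \<lambda>u\<in>words n ?T. c (u @ v)) S \<sigma>" by blast
    then have "c (u @ fill a \<sigma>) = c (u @ fill a0 \<sigma>)" if "u \<in> words n ?T" "a \<in> S" for u a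
      using that a0 unfolding mono_line_def by (metis (no_types, lifting) restrict_apply')
    moreover define c' where "c' = (\<lambda>u. c (u @ fill a0 \<sigma>))"
    ultimately have eq: "c (u @ fill a \<sigma>) = c' u" if "u \<in> words n ?T" "a \<in> S" for u a
      using that by simp
    have \<sigma>T: "\<sigma> \<in> lines m ?T" using \<sigma> lines_mono[of S ?T m] by blast
    have w0: "fill a0 \<sigma> \<in> words m ?T" by (rule fill_in_words[OF \<sigma>T]) (simp add: a0)
    have c': "c' \<in> words n ?T \<rightarrow> {..<r}"
      using c words_append[OF _ w0] by (auto simp: c'_def)
    have lift: "\<exists>\<tau>\<in>lines (n + m) ?T. mono_line c ?T \<tau>"
      if "\<tau> \<in> lines n ?T" "mono_line c' ?T \<tau>" for \<tau>
    proof
      show "mono_line c ?T (\<tau> @ map Some (fill a0 \<sigma>))"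
        using that(2) unfolding mono_line_def c'_def fill_append fill_map_Some .
    qed (rule lines_append_word[OF that(1) w0])
    show "(\<exists>\<tau>\<in>lines (n + m) ?T. mono_line c ?T \<tau>) \<or>
      (\<exists>f\<in>words (n + m) ?T. \<exists>C\<subseteq>{..<r}. card C = Suc s \<and> focused c (n + m) S t f C)"
      using n[OF c']
    proof (elim disjE bexE exE conjE)
      fix \<tau> assume "\<tau> \<in> lines n ?T" "mono_line c' ?T \<tau>"
      then show ?thesis using lift by blast
    next
      fix f C assume f: "f \<in> words n ?T" and C: "C \<subseteq> {..<r}" "card C = s"
        and foc: "focused c' n S t f C"
      show ?thesis
      proof (cases "c' f \<in> C")
        case True
        then obtain \<tau> where \<tau>: "\<tau> \<in> lines n ?T" "fill t \<tau> = f" "\<forall>a\<in>S. c' (fill a \<tau>) = c' f"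
          using foc by (auto simp: focused_def)
        \<comment> \<open>At \<open>t\<close> this line meets the focus, which has the same colour
          as the rest of the line.\<close>
        from \<tau>(2,3) have "mono_line c' ?T \<tau>" by (simp add: mono_line_def)
        with \<tau>(1) show ?thesis using lift by blast
      next
        case False
        have "\<exists>\<tau>\<in>lines (n + m) ?T. fill t \<tau> = f @ fill t \<sigma> \<and> (\<forall>a\<in>S. c (fill a \<tau>) = q)"
          if q: "q \<in> insert (c' f) C" for q
        proof (cases "q \<in> C")
          case True
          then obtain \<tau> where \<tau>: "\<tau> \<in> lines n ?T" "fill t \<tau> = f" "\<forall>a\<in>S. c' (fill a \<tau>) = q"
            using foc by (auto simp: focused_def)
          \<comment> \<open>An old colour: prefix and suffix move together, so the line meets the
            new focus at \<open>t\<close>.\<close>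
          then show ?thesis
            using lines_append[OF \<tau>(1) \<sigma>T] fill_in_words[OF \<tau>(1)]
            by (intro bexI[of _ "\<tau> @ \<sigma>"]) (simp_all add: eq)
        next
          case False
          with q have "q = c' f" by simp
          \<comment> \<open>The new colour: the prefix is frozen at \<open>f\<close> and only the
            suffix moves.\<close>
          then show ?thesis
            using lines_word_append[OF f \<sigma>T]
            by (intro bexI[of _ "map Some f @ \<sigma>"]) (simp_all add: eq[OF f])
        qed
        then have "focused c (n + m) S t (f @ fill t \<sigma>) (insert (c' f) C)"
          by (simp add: focused_def)
        moreover have "f @ fill t \<sigma> \<in> words (n + m) ?T"
          using words_append[OF f fill_in_words[OF \<sigma>T]] by simp
        moreover have "insert (c' f) C \<subseteq> {..<r}" using C c' f by auto
        moreover have "card (insert (c' f) C) = Suc s"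
          using False C finite_subset[OF C(1)] by simp
        ultimately show ?thesis by blast
      qed
    qed
  qed
qed

text \<open>Letters are added one at a time. With \<open>s = r\<close> the focused set contains all
  colours, hence that of the focus itself, and the line of this colour stays monochromatic at the
  new letter.\<close>

theorem hales_jewett: "finite S \<Longrightarrow> hales_jewett S"
proof (induction S rule: finite_induct)
  case empty
  have "[None] \<in> lines 1 {}" by (simp add: lines_def)
  then show ?case unfolding hales_jewett_def mono_line_def by blast
next
  case (insert t S)
  show ?case
  proof (cases "S = {}")
    case True
    \<comment> \<open>Focusing fixes a letter of \<open>S\<close>, so the one-letter alphabet is
      treated apart; there every line is monochromatic.\<close>
    have "[None] \<in> lines 1 {t}" by (simp add: lines_def)
    then show ?thesis unfolding hales_jewett_def mono_line_def True by blast
  next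
    case False
    show ?thesis
      unfolding hales_jewett_def
    proof
      fix r
      obtain n where n: "\<And>c :: 'a list \<Rightarrow> nat. c \<in> words n (insert t S) \<rightarrow> {..<r} \<Longrightarrow>
        (\<exists>\<tau>\<in>lines n (insert t S). mono_line c (insert t S) \<tau>) \<or>
        (\<exists>f\<in>words n (insert t S). \<exists>C\<subseteq>{..<r}. card C = r \<and> focused c n S t f C)"
        using colour_focusing[OF insert.IH insert.hyps(1) False, of t r r] by blast
      have "\<exists>\<tau>\<in>lines n (insert t S). mono_line c (insert t S) \<tau>"
        if c: "c \<in> words n (insert t S) \<rightarrow> {..<r}" for c
        using n[OF c]
      proof (elim disjE bexE exE conjE)
        fix f C assume f: "f \<in> words n (insert t S)" and C: "C \<subseteq> {..<r}" "card C = r"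
          and foc: "focused c n S t f C"
        have "C = {..<r}" using C by (intro card_subset_eq) auto
        with c f have "c f \<in> C" by auto
        then obtain \<tau> where "\<tau> \<in> lines n (insert t S)" "fill t \<tau> = f" "\<forall>a\<in>S. c (fill a \<tau>) = c f"
          using foc by (auto simp: focused_def)
        then show ?thesis by (intro bexI[of _ \<tau>]) (simp_all add: mono_line_def)
      qed blast
      then show "\<exists>n. \<forall>c. c \<in> words n (insert t S) \<rightarrow> {..<r} \<longrightarrow>
          (\<exists>\<tau>\<in>lines n (insert t S). mono_line c (insert t S) \<tau>)" by blast
    qed
  qed
qed

section \<open>The partite construction\<close>

text \<open>The parts are the fibres of \<open>proj\<close>. No order is stored: on transversal
  copies the order of the parts will supply it.\<close>

record 'p psys =
  pts :: "'p set"
  act :: "nat \<Rightarrow> 'p \<Rightarrow> 'p"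
  proj :: "'p \<Rightarrow> nat"

text \<open>The conditions on \<open>F_class\<close> are local: they concern only the forward orbit of one point.\<close>

definition good_at :: "nat set \<Rightarrow> (nat \<Rightarrow> 'p \<Rightarrow> 'p) \<Rightarrow> 'p \<Rightarrow> bool" where
  "good_at I F x \<longleftrightarrow> (\<forall>i\<in>I. F i x \<noteq> x \<longrightarrow> (\<forall>j\<in>I. (j \<noteq> i \<longrightarrow> F j x \<noteq> F i x) \<and> F j (F i x) \<noteq> x))"

definition partite :: "nat set \<Rightarrow> 'p psys \<Rightarrow> bool" where
  "partite I P \<longleftrightarrow> finite (pts P) \<and>
     (\<forall>x\<in>pts P. good_at I (act P) x \<and> (\<forall>i\<in>I. act P i x \<in> pts P))"

definition pemb :: "nat set \<Rightarrow> 'p psys \<Rightarrow> 'q psys \<Rightarrow> ('p \<Rightarrow> 'q) \<Rightarrow> bool" where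
  "pemb I P Q h \<longleftrightarrow> inj_on h (pts P) \<and>
     (\<forall>x\<in>pts P. h x \<in> pts Q \<and> proj Q (h x) = proj P x \<and> (\<forall>i\<in>I. act Q i (h x) = h (act P i x)))"

text \<open>The occurrences in \<open>P\<close> of the pattern with points \<open>{..<length s}\<close> and functions \<open>g\<close>, where
  the point \<open>j\<close> lies in the part \<open>s ! j\<close>.\<close>

definition occs :: "nat set \<Rightarrow> (nat \<Rightarrow> nat \<Rightarrow> nat) \<Rightarrow> 'p psys \<Rightarrow> nat list \<Rightarrow> 'p list set" where
  "occs I g P s = {xs. set xs \<subseteq> pts P \<and> map (proj P) xs = s \<and>
     (\<forall>i\<in>I. \<forall>j<length s. act P i (xs ! j) = xs ! g i j)}"

lemma occs_length: "xs \<in> occs I g P s \<Longrightarrow> length xs = length s"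
  by (auto simp: occs_def)

lemma finite_occs: "finite (pts P) \<Longrightarrow> finite (occs I g P s)"
  by (rule finite_subset[OF _ finite_lists_length_eq[of "pts P" "length s"]])
     (auto simp: occs_def)

text \<open>The condition only compares points of \<open>U\<close> reached from \<open>x\<close> in
  at most two steps, and \<open>h\<close> is injective and equivariant on \<open>U\<close>.\<close>

lemma good_at_transfer:
  assumes "good_at I F x" and "\<And>i. i \<in> I \<Longrightarrow> F i x \<in> U" and "x \<in> U"
    and "\<And>i y. i \<in> I \<Longrightarrow> y \<in> U \<Longrightarrow> F i y \<in> U"
    and "inj_on h U" and "\<And>i y. i \<in> I \<Longrightarrow> y \<in> U \<Longrightarrow> G i (h y) = h (F i y)"
  shows "good_at I G (h x)"
  using assms unfolding good_at_def inj_on_def by metis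

lemma pemb_good_at:
  assumes "partite I P" "pemb I P Q h" "x \<in> pts P"
  shows "good_at I (act Q) (h x)"
  by (rule good_at_transfer[where U = "pts P" and F = "act P"])
     (use assms in \<open>auto simp: partite_def pemb_def\<close>)

lemma pemb_comp:
  assumes "partite I P" "pemb I P Q h" "pemb I Q R h'"
  shows "pemb I P R (h' \<circ> h)"
  using assms by (auto simp: pemb_def partite_def inj_on_def)

lemma occs_map:
  assumes g: "\<And>i j. i \<in> I \<Longrightarrow> j < length s \<Longrightarrow> g i j < length s"
    and "pemb I P Q h" and xs: "xs \<in> occs I g P s"
  shows "map h xs \<in> occs I g Q s"
proof -
  note len = occs_length[OF xs]
  have h: "h x \<in> pts Q" "proj Q (h x) = proj P x" "\<And>i. i \<in> I \<Longrightarrow> act Q i (h x) = h (act P i x)"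
    if "x \<in> set xs" for x
    using that assms(2) xs by (auto simp: pemb_def occs_def)
  have "act Q i (map h xs ! j) = map h xs ! g i j" if "i \<in> I" "j < length s" for i j
    using that xs g[OF that] by (simp add: len h occs_def)
  moreover have "map (proj Q) (map h xs) = s"
    using xs by (simp add: h occs_def cong: map_cong)
  ultimately show ?thesis
    using h by (auto simp: occs_def)
qed

section \<open>One step of the construction, for a fixed tuple of parts\<close>

locale partite_step =
  fixes I :: "nat set" and g :: "nat \<Rightarrow> nat \<Rightarrow> nat" and s :: "nat list"
    and P :: "'p psys" and n :: nat
  assumes s: "distinct s" and P: "partite I P"
    and g: "\<And>i j. i \<in> I \<Longrightarrow> j < length s \<Longrightarrow> g i j < length s"
    and good: "\<And>j. j < length s \<Longrightarrow> good_at I g j"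
begin

abbreviation W :: "'p list set" where "W \<equiv> occs I g P s"

text \<open>Each occurrence is closed under the functions, so this union is a substructure of
  \<open>P\<close>.\<close>

definition D :: "'p set" where "D = (\<Union>e\<in>W. set e)"

text \<open>The projection of \<open>D\<close> to the pattern, well defined because \<open>s\<close>
  is distinct.\<close>

definition ix :: "'p \<Rightarrow> nat" where "ix x = (THE j. j < length s \<and> s ! j = proj P x)"

text \<open>A point of the fibre power over position \<open>j\<close>. Every point of
  \<open>D\<close> belongs to an occurrence, so each \<open>n\<close>-tuple of points of
  \<open>D\<close> in the part \<open>s ! j\<close> arises from some word.\<close>

definition diag :: "nat \<Rightarrow> 'p list list \<Rightarrow> (nat \<times> 'p list) + ('p list option list \<times> 'p)" where
  "diag j w = Inl (j, map (\<lambda>e. e ! j) w)"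

text \<open>A point of \<open>D\<close> is written at the moving coordinates, and each fixed letter
  contributes its own point in the same part. Points outside \<open>D\<close> are tagged with the
  line, so that different copies of \<open>P\<close> meet only inside the power of
  \<open>D\<close>.\<close>

definition line_emb ::
    "'p list option list \<Rightarrow> 'p \<Rightarrow> (nat \<times> 'p list) + ('p list option list \<times> 'p)" where
  "line_emb \<tau> x = (if x \<in> D then Inl (ix x, map (case_option x (\<lambda>e. e ! ix x)) \<tau>) else Inr (\<tau>, x))"

text \<open>The power of \<open>D\<close> over the pattern is extended, for every combinatorial line \<open>\<tau>\<close>, by a copy
  of \<open>P\<close> amalgamated along the copy of \<open>D\<close> that \<open>\<tau>\<close> determines.\<close>

definition amalgam :: "((nat \<times> 'p list) + ('p list option list \<times> 'p)) psys" where
  "amalgam = \<lparr>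
     pts = (\<Union>j<length s. diag j ` words n W) \<union> Inr ` (lines n W \<times> (pts P - D)),
     act = (\<lambda>i. case_sum (\<lambda>(j, v). Inl (g i j, map (act P i) v)) (\<lambda>(\<tau>, x). line_emb \<tau> (act P i x))),
     proj = case_sum (\<lambda>(j, v). s ! j) (\<lambda>(\<tau>, x). proj P x) \<rparr>"

lemma ix:
  assumes "e \<in> W" "j < length s"
  shows "ix (e ! j) = j"
proof -
  have "proj P (e ! j) = s ! j" using assms by (auto simp: occs_def)
  then show ?thesis
    unfolding ix_def using assms(2) s by (intro the_equality) (auto simp: nth_eq_iff_index_eq)
qed

lemma act_occ: "e \<in> W \<Longrightarrow> i \<in> I \<Longrightarrow> j < length s \<Longrightarrow> act P i (e ! j) = e ! g i j"
  by (auto simp: occs_def)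

lemma D_cases:
  assumes "x \<in> D"
  obtains e j where "e \<in> W" "j < length s" "x = e ! j"
  using assms by (fastforce simp: D_def in_set_conv_nth occs_length)

lemma nth_in_D: "e \<in> W \<Longrightarrow> j < length s \<Longrightarrow> e ! j \<in> D"
  unfolding D_def by (metis UN_I nth_mem occs_length)

text \<open>The link between lines and embeddings: the copy of \<open>P\<close> given by a line
  carries the occurrence \<open>e\<close> to the occurrence spelled by the word with
  \<open>e\<close> filled in.\<close>

lemma line_emb_occ:
  assumes "e \<in> W" "j < length s"
  shows "line_emb \<tau> (e ! j) = diag j (fill e \<tau>)"
  using assms by (auto simp: line_emb_def nth_in_D ix diag_def fill_def split: option.split)

lemma act_diag:
  assumes "w \<in> words n W" "i \<in> I" "j < length s"
  shows "act amalgam i (diag j w) = diag (g i j) w"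
  using assms by (auto simp: amalgam_def diag_def words_def act_occ subset_iff)

text \<open>On \<open>D\<close> it suffices to look at points \<open>e ! j\<close>, where the
  functions just change the position \<open>j\<close>. Outside \<open>D\<close> the amalgam defines
  its functions through \<open>line_emb\<close>, so equivariance is built in.\<close>

lemma line_emb_pemb:
  assumes \<tau>: "\<tau> \<in> lines n W"
  shows "pemb I P amalgam (line_emb \<tau>)"
  unfolding pemb_def
proof (intro conjI ballI)
  \<comment> \<open>A point of \<open>D\<close> can be read off at a moving coordinate, and a line
    has one.\<close>
  show "inj_on (line_emb \<tau>) (pts P)"
    using \<tau> by (auto simp: inj_on_def line_emb_def lines_def split: if_splits)
next
  fix x assume x: "x \<in> pts P"
  show "line_emb \<tau> x \<in> pts amalgam"
  proof (cases "x \<in> D")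
    case True
    then obtain e j where e: "e \<in> W" "j < length s" "x = e ! j" by (rule D_cases)
    have "fill e \<tau> \<in> words n W" by (rule fill_in_words[OF \<tau> e(1)])
    then show ?thesis using e by (auto simp: line_emb_occ amalgam_def)
  qed (use x \<tau> in \<open>auto simp: line_emb_def amalgam_def\<close>)
  show "proj amalgam (line_emb \<tau> x) = proj P x"
  proof (cases "x \<in> D")
    case True
    then obtain e j where e: "e \<in> W" "j < length s" "x = e ! j" by (rule D_cases)
    moreover from this have "proj P (e ! j) = s ! j" by (auto simp: occs_def)
    ultimately show ?thesis by (simp add: line_emb_occ amalgam_def diag_def)
  qed (simp add: line_emb_def amalgam_def)
  fix i assume i: "i \<in> I"
  show "act amalgam i (line_emb \<tau> x) = line_emb \<tau> (act P i x)"
  proof (cases "x \<in> D")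
    case True
    then obtain e j where e: "e \<in> W" "j < length s" "x = e ! j" by (rule D_cases)
    have "fill e \<tau> \<in> words n W" by (rule fill_in_words[OF \<tau> e(1)])
    then show ?thesis using e i by (simp add: line_emb_occ act_diag act_occ g)
  qed (simp add: line_emb_def amalgam_def)
qed

lemma diag_pts: "w \<in> words n W \<Longrightarrow> j < length s \<Longrightarrow> diag j w \<in> pts amalgam"
  by (auto simp: amalgam_def)

text \<open>Every point lies in the copy of the pattern given by a word or in the copy of
  \<open>P\<close> given by a line. Both are closed under the functions, so the local conditions are
  inherited.\<close>

lemma partite_amalgam: "partite I amalgam"
  unfolding partite_def
proof (intro conjI ballI)
  have fin: "finite (pts P)" "finite W" using P by (auto simp: partite_def finite_occs)
  then show "finite (pts amalgam)"
    by (auto simp: amalgam_def intro!: finite_words finite_lines)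
  fix z assume "z \<in> pts amalgam"
  then consider (diag) j w where "j < length s" "w \<in> words n W" "z = diag j w"
    | (copy) \<tau> x where "\<tau> \<in> lines n W" "x \<in> pts P" "z = line_emb \<tau> x"
    by (auto simp: amalgam_def line_emb_def)
  then have "good_at I (act amalgam) z \<and> (\<forall>i\<in>I. act amalgam i z \<in> pts amalgam)"
  proof cases
    case diag
    have "good_at I (act amalgam) z"
      unfolding good_at_def
    proof (intro ballI impI)
      fix i l assume i: "i \<in> I" and l: "l \<in> I" and ne: "act amalgam i z \<noteq> z"
      \<comment> \<open>The position is stored in the point, so inequalities between positions carry
        over from \<open>good\<close>.\<close>
      have neq: "diag p w \<noteq> diag q w" if "p \<noteq> q" for p q using that by (simp add: diag_def)
      have "g i j \<noteq> j" using ne diag i by (auto simp: act_diag)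
      then have "(l \<noteq> i \<longrightarrow> g l j \<noteq> g i j) \<and> g l (g i j) \<noteq> j"
        using good[OF diag(1)] i l by (simp add: good_at_def)
      then show "(l \<noteq> i \<longrightarrow> act amalgam l z \<noteq> act amalgam i z) \<and> act amalgam l (act amalgam i z) \<noteq> z"
        using diag i l g neq by (simp add: act_diag)
    qed
    then show ?thesis using diag by (simp add: act_diag diag_pts g)
  next
    case copy
    then have "act amalgam i z \<in> pts amalgam" if "i \<in> I" for i
      using that P line_emb_pemb[OF copy(1)] by (auto simp: pemb_def partite_def)
    with copy show ?thesis using pemb_good_at[OF P line_emb_pemb] by simp
  qed
  then show "good_at I (act amalgam) z" and "\<And>i. i \<in> I \<Longrightarrow> act amalgam i z \<in> pts amalgam"
    by simp_all
qed

lemma diag_occ: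
  assumes "w \<in> words n W"
  shows "map (\<lambda>j. diag j w) [0..<length s] \<in> occs I g amalgam s"
proof -
  have "proj amalgam (diag j w) = s ! j" for j by (simp add: amalgam_def diag_def)
  then have "map (proj amalgam) (map (\<lambda>j. diag j w) [0..<length s]) = s"
    by (simp add: o_def map_nth)
  then show ?thesis
    using assms by (auto simp: occs_def diag_pts act_diag g)
qed

lemma map_line_emb:
  assumes "e \<in> W"
  shows "map (line_emb \<tau>) e = map (\<lambda>j. diag j (fill e \<tau>)) [0..<length s]"
  by (rule nth_equalityI) (simp_all add: occs_length[OF assms] line_emb_occ[OF assms])

end

definition constant_on :: "('a \<Rightarrow> 'c) \<Rightarrow> 'a set \<Rightarrow> bool" where
  "constant_on c X \<longleftrightarrow> (\<forall>x\<in>X. \<forall>y\<in>X. c x = c y)"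

lemma partite_step_Ramsey:
  fixes P :: "nat psys" and r :: nat
  assumes "distinct s" "partite I P"
    and g: "\<And>i j. i \<in> I \<Longrightarrow> j < length s \<Longrightarrow> g i j < length s"
    and "\<And>j. j < length s \<Longrightarrow> good_at I g j"
  obtains Q :: "nat psys" where "partite I Q"
    and "\<And>c. c \<in> occs I g Q s \<rightarrow> {..<r} \<Longrightarrow>
      \<exists>h. pemb I P Q h \<and> constant_on (c \<circ> map h) (occs I g P s)"
proof -
  have "finite (occs I g P s)" using assms(2) by (auto simp: partite_def finite_occs)
  then obtain n where n: "\<And>c :: nat list list \<Rightarrow> nat. c \<in> words n (occs I g P s) \<rightarrow> {..<r} \<Longrightarrow>
      \<exists>\<tau>\<in>lines n (occs I g P s). mono_line c (occs I g P s) \<tau>"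
    using hales_jewett unfolding hales_jewett_def by blast
  interpret partite_step I g s P n using assms by unfold_locales
  \<comment> \<open>Recoding the points as naturals keeps the type fixed, so that the step can be
    iterated.\<close>
  define Q :: "nat psys" where
    "Q = \<lparr> pts = to_nat ` pts amalgam, act = (\<lambda>i. to_nat \<circ> act amalgam i \<circ> from_nat),
           proj = proj amalgam \<circ> from_nat \<rparr>"
  have emb: "pemb I amalgam Q to_nat"
    by (auto simp: pemb_def Q_def)
  have "good_at I (act Q) (to_nat x)" if "x \<in> pts amalgam" for x
    using pemb_good_at[OF partite_amalgam emb that] .
  then have "partite I Q"
    using partite_amalgam by (auto simp: partite_def Q_def)
  moreover have "\<exists>h. pemb I P Q h \<and> constant_on (c \<circ> map h) W" if c: "c \<in> occs I g Q s \<rightarrow> {..<r}" for c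
  proof -
    \<comment> \<open>A word gets the colour of the occurrence it spells in
      \<open>Q\<close>.\<close>
    define d where "d = (\<lambda>w. c (map to_nat (map (\<lambda>j. diag j w) [0..<length s])))"
    have "d \<in> words n W \<rightarrow> {..<r}"
      unfolding d_def using occs_map[OF g emb diag_occ] by (intro Pi_I Pi_mem[OF c])
    then obtain \<tau> where \<tau>: "\<tau> \<in> lines n W" "mono_line d W \<tau>" using n by blast
    have "c (map (to_nat \<circ> line_emb \<tau>) e) = d (fill e \<tau>)" if "e \<in> W" for e
      unfolding d_def using map_line_emb[OF that, of \<tau>] by (metis map_map)
    then have "constant_on (c \<circ> map (to_nat \<circ> line_emb \<tau>)) W"
      using \<tau>(2) unfolding constant_on_def mono_line_def o_apply by metis
    moreover have "pemb I P Q (to_nat \<circ> line_emb \<tau>)"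
      by (rule pemb_comp[OF P line_emb_pemb[OF \<tau>(1)] emb])
    ultimately show ?thesis by blast
  qed
  ultimately show thesis by (rule that)
qed

text \<open>Each tuple of \<open>Ss\<close> is handled by a step above the previous system. A
  colouring of the last system is unwound backwards: \<open>h1\<close> settles the later tuples
  within \<open>P1\<close>, and then \<open>h\<close> settles the first one.\<close>

lemma partite_iterate:
  fixes P :: "nat psys" and r :: nat
  assumes "partite I P" and "\<And>s. s \<in> set Ss \<Longrightarrow> distinct s \<and> length s = a"
    and g: "\<And>i j. i \<in> I \<Longrightarrow> j < a \<Longrightarrow> g i j < a"
    and good: "\<And>j. j < a \<Longrightarrow> good_at I g j"
  shows "\<exists>Q :: nat psys. partite I Q \<and> (\<forall>c. (\<forall>s\<in>set Ss. c \<in> occs I g Q s \<rightarrow> {..<r}) \<longrightarrow>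
    (\<exists>h. pemb I P Q h \<and> (\<forall>s\<in>set Ss. constant_on (c \<circ> map h) (occs I g P s))))"
  using assms(1,2)
proof (induction Ss arbitrary: P)
  case Nil
  have "pemb I P P (\<lambda>x. x)" by (simp add: pemb_def)
  with Nil(1) show ?case by auto
next
  case (Cons s Ss)
  have s: "distinct s" "length s = a" using Cons.prems by auto
  obtain P1 :: "nat psys" where P1: "partite I P1"
    and step: "\<And>c. c \<in> occs I g P1 s \<rightarrow> {..<r} \<Longrightarrow>
      \<exists>h. pemb I P P1 h \<and> constant_on (c \<circ> map h) (occs I g P s)"
    using partite_step_Ramsey[of s I P g r] s g good Cons.prems(1) by metis
  obtain Q :: "nat psys" where Q: "partite I Q"
    and iter: "\<And>c. \<forall>s\<in>set Ss. c \<in> occs I g Q s \<rightarrow> {..<r} \<Longrightarrow>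
      \<exists>h. pemb I P1 Q h \<and> (\<forall>s\<in>set Ss. constant_on (c \<circ> map h) (occs I g P1 s))"
    using Cons.IH[OF P1 Cons.prems(2)] by (meson list.set_intros(2))
  show ?case
  proof (intro exI[of _ Q] conjI allI impI)
    show "partite I Q" by (rule Q)
    fix c assume c: "\<forall>s\<in>set (s # Ss). c \<in> occs I g Q s \<rightarrow> {..<r}"
    then obtain h1 where h1: "pemb I P1 Q h1"
      "\<forall>s\<in>set Ss. constant_on (c \<circ> map h1) (occs I g P1 s)"
      using iter[of c] by auto
    have "c \<circ> map h1 \<in> occs I g P1 s \<rightarrow> {..<r}"
      using c occs_map[of I s g, OF _ h1(1)] g s(2) by (auto simp: Pi_iff)
    then obtain h where h: "pemb I P P1 h" "constant_on (c \<circ> map h1 \<circ> map h) (occs I g P s)"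
      using step by blast
    \<comment> \<open>\<open>h\<close> sends occurrences over \<open>s'\<close> to occurrences in
      \<open>P1\<close>, where the colour is already constant.\<close>
    have "constant_on (c \<circ> map (h1 \<circ> h)) (occs I g P s')" if "s' \<in> set Ss" for s'
    proof -
      have "length s' = a" using that Cons.prems(2) by simp
      then have "map h xs \<in> occs I g P1 s'" if "xs \<in> occs I g P s'" for xs
        using occs_map[of I s' g, OF _ h(1) that] g by simp
      then show ?thesis using h1(2) that unfolding constant_on_def o_apply map_map[symmetric] by blast
    qed
    moreover have "constant_on (c \<circ> map (h1 \<circ> h)) (occs I g P s)"
      using h(2) unfolding constant_on_def o_apply map_map[symmetric] .
    ultimately show "\<exists>h. pemb I P Q h \<and> (\<forall>s\<in>set (s # Ss). constant_on (c \<circ> map h) (occs I g P s))"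
      using pemb_comp[OF Cons.prems(1) h(1) h1(1)] by auto
  qed
qed

section \<open>Patterns on initial segments and the Ramsey theorem for partite systems\<close>

definition pattern :: "nat set \<Rightarrow> nat \<Rightarrow> (nat \<Rightarrow> nat \<Rightarrow> nat) \<Rightarrow> bool" where
  "pattern I a g \<longleftrightarrow> (\<forall>j<a. good_at I g j \<and> (\<forall>i\<in>I. g i j < a))"

text \<open>An ordered embedding of one pattern into another, as the list of its values.\<close>

definition sub_pattern :: "nat set \<Rightarrow> nat \<Rightarrow> (nat \<Rightarrow> nat \<Rightarrow> nat) \<Rightarrow> nat \<Rightarrow> (nat \<Rightarrow> nat \<Rightarrow> nat) \<Rightarrow>
    nat list \<Rightarrow> bool" where
  "sub_pattern I a g b g' p \<longleftrightarrow> sorted_wrt (<) p \<and> length p = a \<and> set p \<subseteq> {..<b} \<and>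
     (\<forall>i\<in>I. \<forall>j<a. g' i (p ! j) = p ! g i j)"

lemma occs_sub_pattern:
  assumes p: "sub_pattern I a g b g' p" and g: "pattern I a g"
    and zs: "zs \<in> occs I g' Q t" and t: "length t = b"
  shows "map ((!) zs) p \<in> occs I g Q (map ((!) t) p)"
proof -
  have p': "length p = a" "p ! j < b" if "j < a" for j
    using p that nth_mem[of j p] unfolding sub_pattern_def by blast+
  have len: "length p = a" "length zs = b" using p occs_length[OF zs] t by (auto simp: sub_pattern_def)
  have "zs ! v \<in> pts Q \<and> proj Q (zs ! v) = t ! v" if "v \<in> set p" for v
  proof -
    have "v < length zs" using that p len by (auto simp: sub_pattern_def)
    then show ?thesis using zs nth_mem[of v zs] by (auto simp: occs_def)
  qed
  then have "set (map ((!) zs) p) \<subseteq> pts Q" "map (proj Q) (map ((!) zs) p) = map ((!) t) p"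
    by auto
  moreover have "act Q i (map ((!) zs) p ! j) = map ((!) zs) p ! g i j" if "i \<in> I" "j < a" for i j
    using that p g zs p'(2)[OF that(2)] len t by (simp add: sub_pattern_def occs_def pattern_def)
  ultimately show ?thesis by (simp add: occs_def len)
qed

lemma sorted_sub_pattern:
  assumes "sub_pattern I a g b g' p" "sorted_wrt (<) t" "length t = b"
  shows "sorted_wrt (<) (map ((!) t) p)"
proof -
  have p: "p ! j < b" if "j < length p" for j
    using assms(1) nth_mem[OF that] unfolding sub_pattern_def by blast
  show ?thesis
    unfolding sorted_wrt_iff_nth_less
  proof (intro allI impI)
    fix i j assume "i < j" "j < length (map ((!) t) p)"
    then show "map ((!) t) p ! i < map ((!) t) p ! j"
      using assms p by (simp add: sub_pattern_def sorted_wrt_nth_less)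
  qed
qed

theorem partite_ramsey:
  fixes r :: nat
  assumes A: "pattern I a g" and B: "pattern I b g'" and "0 < r"
  obtains Q :: "nat psys" where "partite I Q"
    and "\<And>c. (\<And>s. sorted_wrt (<) s \<Longrightarrow> length s = a \<Longrightarrow> c \<in> occs I g Q s \<rightarrow> {..<r}) \<Longrightarrow>
      \<exists>q<r. \<exists>t zs. sorted_wrt (<) t \<and> length t = b \<and> zs \<in> occs I g' Q t \<and>
        (\<forall>p. sub_pattern I a g b g' p \<longrightarrow> c (map ((!) zs) p) = q)"
proof -
  \<comment> \<open>One entry \<open>b\<close> per colour: whichever colour is homogeneous, the set
    has \<open>b\<close> elements.\<close>
  obtain n :: nat where n: "partn_lst {..<n} (replicate r b) a"
    using ramsey_full by blast
  define T where "T = sorted_list_of_set ` nsets {..<n} b"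
  \<comment> \<open>The starting system: disjoint copies of the pattern \<open>g'\<close>, one over
    each increasing \<open>b\<close>-tuple \<open>t\<close> of parts, with vertex \<open>v\<close>
    in the part \<open>t ! v\<close>.\<close>
  define P :: "nat psys" where
    "P = \<lparr> pts = to_nat ` (T \<times> {..<b}),
           act = (\<lambda>i x. case from_nat x of (t :: nat list, v) \<Rightarrow> to_nat (t, g' i v)),
           proj = (\<lambda>x. case from_nat x of (t, v) \<Rightarrow> t ! v) \<rparr>"
  have P_simps: "act P i (to_nat (t, v)) = to_nat (t, g' i v)" "proj P (to_nat (t, v)) = t ! v"
    for i t v by (simp_all add: P_def)
  have T: "sorted_wrt (<) t \<and> length t = b \<and> set t \<subseteq> {..<n}" if "t \<in> T" for t
    using that by (auto simp: T_def nsets_def)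
  have "good_at I (act P) (to_nat (t, v))" if "v < b" for t :: "nat list" and v
    using B that by (simp add: good_at_def P_simps pattern_def)
  moreover have "finite T" by (simp add: T_def finite_imp_finite_nsets)
  ultimately have P: "partite I P"
    using B by (auto simp: partite_def P_def pattern_def)
  define SA where "SA = sorted_list_of_set ` nsets {..<n} a"
  have "finite SA" by (simp add: SA_def finite_imp_finite_nsets)
  then obtain Ss where Ss: "set Ss = SA" using finite_list by blast
  have SA: "sorted_wrt (<) s \<and> distinct s \<and> length s = a" if "s \<in> SA" for s
    using that by (auto simp: SA_def nsets_def)
  have "\<exists>Q :: nat psys. partite I Q \<and> (\<forall>c. (\<forall>s\<in>set Ss. c \<in> occs I g Q s \<rightarrow> {..<r}) \<longrightarrow>
    (\<exists>h. pemb I P Q h \<and> (\<forall>s\<in>set Ss. constant_on (c \<circ> map h) (occs I g P s))))"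
    by (rule partite_iterate[OF P, of Ss a]) (use SA A in \<open>auto simp: Ss pattern_def\<close>)
  then obtain Q :: "nat psys" where Q: "partite I Q" and iter:
    "\<forall>c. (\<forall>s\<in>SA. c \<in> occs I g Q s \<rightarrow> {..<r}) \<longrightarrow>
      (\<exists>h. pemb I P Q h \<and> (\<forall>s\<in>SA. constant_on (c \<circ> map h) (occs I g P s)))"
    unfolding Ss by blast
  have "\<exists>q<r. \<exists>t zs. sorted_wrt (<) t \<and> length t = b \<and> zs \<in> occs I g' Q t \<and>
      (\<forall>p. sub_pattern I a g b g' p \<longrightarrow> c (map ((!) zs) p) = q)"
    if c: "\<And>s. sorted_wrt (<) s \<Longrightarrow> length s = a \<Longrightarrow> c \<in> occs I g Q s \<rightarrow> {..<r}" for c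
  proof -
    obtain h where h: "pemb I P Q h"
      and const: "\<forall>s\<in>SA. constant_on (c \<circ> map h) (occs I g P s)"
      using iter c SA by meson
    \<comment> \<open>Along \<open>h\<close> the colour depends only on the set of parts. Where no
      occurrence exists any colour serves, and \<open>0 < r\<close> provides one.\<close>
    have "\<exists>q<r. \<forall>ys\<in>occs I g P (sorted_list_of_set S). c (map h ys) = q"
      if S: "S \<in> nsets {..<n} a" for S
    proof (cases "occs I g P (sorted_list_of_set S) = {}")
      case True
      then show ?thesis using \<open>0 < r\<close> by auto
    next
      case False
      then obtain ys where ys: "ys \<in> occs I g P (sorted_list_of_set S)" by blast
      have s: "sorted_list_of_set S \<in> SA" using S by (simp add: SA_def)
      have "map h ys \<in> occs I g Q (sorted_list_of_set S)"
        using occs_map[OF _ h ys] A SA[OF s] by (simp add: pattern_def)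
      then have "c (map h ys) < r" using c SA[OF s] by blast
      then show ?thesis using const s ys unfolding constant_on_def o_apply by blast
    qed
    then obtain f where f: "\<forall>S\<in>nsets {..<n} a. f S < r \<and>
        (\<forall>ys\<in>occs I g P (sorted_list_of_set S). c (map h ys) = f S)"
      using bchoice[of "nsets {..<n} a" "\<lambda>S q. q < r \<and>
        (\<forall>ys\<in>occs I g P (sorted_list_of_set S). c (map h ys) = q)"] by blast
    have "f \<in> nsets {..<n} a \<rightarrow> {..<length (replicate r b)}" using f by auto
    then obtain q H where q: "q < r" and H: "H \<in> nsets {..<n} b" and fH: "f ` nsets H a \<subseteq> {q}"
      using n unfolding partn_lst_def monochromatic_def by fastforce
    define t where "t = sorted_list_of_set H"
    have t: "t \<in> T" using H by (simp add: t_def T_def)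
    note t' = T[OF t]
    have set_t: "set t = H" using H by (auto simp: t_def nsets_def)
    \<comment> \<open>The image of the starting copy over the homogeneous set.\<close>
    define zs where "zs = map h (map (\<lambda>v. to_nat (t, v)) [0..<b])"
    have zs0: "map (\<lambda>v. to_nat (t, v)) [0..<b] \<in> occs I g' P t"
    proof -
      have "map (proj P) (map (\<lambda>v. to_nat (t, v)) [0..<b]) = t"
        using t' by (auto simp: P_simps o_def map_nth)
      moreover have "set (map (\<lambda>v. to_nat (t, v)) [0..<b]) \<subseteq> pts P"
        using t by (auto simp: P_def)
      ultimately show ?thesis
        using t' B by (simp add: occs_def P_simps pattern_def)
    qed
    then have zs: "zs \<in> occs I g' Q t"
      unfolding zs_def by (intro occs_map[OF _ h]) (use B t' in \<open>auto simp: pattern_def\<close>)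
    \<comment> \<open>A sub-pattern of this copy occupies an \<open>a\<close>-subset of
      \<open>H\<close>, whose colour is \<open>q\<close>.\<close>
    have "c (map ((!) zs) p) = q" if p: "sub_pattern I a g b g' p" for p
    proof -
      have p': "length p = a" "set p \<subseteq> {..<b}" using p by (auto simp: sub_pattern_def)
      define s where "s = map ((!) t) p"
      have s: "sorted_wrt (<) s" "length s = a" "set s \<subseteq> H"
        using sorted_sub_pattern[OF p] p' t' by (auto simp: s_def simp flip: set_t)
      then have sS: "sorted_list_of_set (set s) = s" "card (set s) = a"
        by (auto simp: sorted_list_of_set.idem_if_sorted_distinct strict_sorted_iff distinct_card)
      then have S: "set s \<in> nsets H a" using s by (simp add: nsets_def)
      define ys where "ys = map ((!) (map (\<lambda>v. to_nat (t, v)) [0..<b])) p"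
      have "ys \<in> occs I g P s"
        unfolding ys_def s_def using t' by (intro occs_sub_pattern[OF p A zs0]) simp
      moreover have "set s \<in> nsets {..<n} a"
        using S H by (auto simp: nsets_def)
      ultimately have "c (map h ys) = f (set s)" using f sS(1) by fastforce
      also have "\<dots> = q" using fH S by auto
      also have "map h ys = map ((!) zs) p"
        using p' by (auto simp: ys_def zs_def)
      finally show ?thesis .
    qed
    with q t' zs show ?thesis by blast
  qed
  with Q show thesis by (rule that)
qed

section \<open>Ordered structures\<close>

text \<open>Two arc sets meet exactly when their functions agree at a point they move, and a pair of
  opposite arcs is a return after two steps. So both global conditions can be checked at single
  points.\<close>

lemma F_class_iff:
  "A \<in> F_class k \<longleftrightarrow> finite (universe A) \<and>
     fn A \<in> {1..k} \<rightarrow>\<^sub>E (universe A \<rightarrow>\<^sub>E universe A) \<and>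
     (\<forall>x\<in>universe A. good_at {1..k} (fn A) x)"
proof (cases "fn A \<in> {1..k} \<rightarrow>\<^sub>E (universe A \<rightarrow>\<^sub>E universe A)")
  case True
  then have cl: "fn A i x \<in> universe A" if "i \<in> {1..k}" "x \<in> universe A" for i x
    using that by (meson PiE_mem)
  have "disjoint_family_on (arcs A) {1..k} \<longleftrightarrow>
      (\<forall>x\<in>universe A. \<forall>i\<in>{1..k}. \<forall>j\<in>{1..k}. fn A i x \<noteq> x \<and> j \<noteq> i \<longrightarrow> fn A j x \<noteq> fn A i x)"
    unfolding disjoint_family_on_def arcs_def by fastforce
  moreover have "oriented_graph (universe A) (\<Union>i\<in>{1..k}. arcs A i) \<longleftrightarrow>
      (\<forall>x\<in>universe A. \<forall>i\<in>{1..k}. \<forall>j\<in>{1..k}. fn A i x \<noteq> x \<longrightarrow> fn A j (fn A i x) \<noteq> x)"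
  proof
    assume "oriented_graph (universe A) (\<Union>i\<in>{1..k}. arcs A i)"
    then have asym: "asym (\<Union>i\<in>{1..k}. arcs A i)" by (simp add: oriented_graph_def)
    show "\<forall>x\<in>universe A. \<forall>i\<in>{1..k}. \<forall>j\<in>{1..k}. fn A i x \<noteq> x \<longrightarrow> fn A j (fn A i x) \<noteq> x"
    proof (intro ballI impI notI)
      fix x i j assume *: "x \<in> universe A" "i \<in> {1..k}" "j \<in> {1..k}" "fn A i x \<noteq> x" "fn A j (fn A i x) = x"
      then have "(x, fn A i x) \<in> arcs A i" "(fn A i x, x) \<in> arcs A j"
        using cl[of i x] by (auto simp: arcs_def)
      with asym *(2,3) show False by (meson UN_I asymD)
    qed
  qed (use cl in \<open>fastforce simp: oriented_graph_def arcs_def intro!: irreflI asymI\<close>)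
  ultimately show ?thesis using True unfolding F_class_def good_at_def by blast
qed (simp add: F_class_def)

section \<open>Coding ordered structures by patterns\<close>

definition codes :: "nat \<Rightarrow> 'v ordered_structure \<Rightarrow> nat \<Rightarrow> (nat \<Rightarrow> nat \<Rightarrow> nat) \<Rightarrow> ('v \<Rightarrow> nat) \<Rightarrow> bool" where
  "codes k A a g \<rho> \<longleftrightarrow> bij_betw \<rho> (universe A) {..<a} \<and> pattern {1..k} a g \<and>
     (\<forall>x\<in>universe A. \<forall>y\<in>universe A. (x, y) \<in> le A \<longleftrightarrow> \<rho> x \<le> \<rho> y) \<and>
     (\<forall>i\<in>{1..k}. \<forall>x\<in>universe A. fn A i x \<in> universe A \<and> \<rho> (fn A i x) = g i (\<rho> x))"

lemma ordered_F_classD: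
  assumes "A \<in> ordered_F_class k"
  shows "finite (universe A)" "linear_order_on (universe A) (le A)"
    and "\<And>i x. i \<in> {1..k} \<Longrightarrow> x \<in> universe A \<Longrightarrow> fn A i x \<in> universe A"
    and "\<And>x. x \<in> universe A \<Longrightarrow> good_at {1..k} (fn A) x"
    and "le A \<subseteq> universe A \<times> universe A"
proof -
  have A: "fun_structure.truncate A \<in> F_class k" "linear_order_on (universe A) (le A)"
    using assms by (auto simp: ordered_F_class_def)
  then show "finite (universe A)" "linear_order_on (universe A) (le A)"
    "\<And>x. x \<in> universe A \<Longrightarrow> good_at {1..k} (fn A) x"
    by (auto simp: F_class_iff fun_structure.truncate_def)
  show "fn A i x \<in> universe A" if "i \<in> {1..k}" "x \<in> universe A" for i x
    using A(1) that unfolding F_class_iff fun_structure.truncate_def by (auto dest!: PiE_mem)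
  show "le A \<subseteq> universe A \<times> universe A"
    using A(2) by (auto simp: order_on_defs refl_on_def)
qed

text \<open>The number of strict predecessors grows strictly along the order, so it is injective,
  and by counting it is onto.\<close>

lemma finite_linear_order_rank:
  assumes "finite U" "linear_order_on U R"
  obtains \<rho> :: "'a \<Rightarrow> nat" where "bij_betw \<rho> U {..<card U}"
    and "\<And>x y. x \<in> U \<Longrightarrow> y \<in> U \<Longrightarrow> (x, y) \<in> R \<longleftrightarrow> \<rho> x \<le> \<rho> y"
proof -
  define \<rho> where "\<rho> x = card {y \<in> U. (y, x) \<in> R \<and> y \<noteq> x}" for x
  have R: "refl_on U R" "trans R" "antisym R" "total_on U R"
    using assms(2) by (auto simp: order_on_defs)
  have less: "\<rho> x < \<rho> y" if "x \<in> U" "y \<in> U" "(x, y) \<in> R" "x \<noteq> y" for x y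
    unfolding \<rho>_def
  proof (rule psubset_card_mono)
    show "{z \<in> U. (z, x) \<in> R \<and> z \<noteq> x} \<subset> {z \<in> U. (z, y) \<in> R \<and> z \<noteq> y}"
      using that R(2,3) by (auto dest: transD antisymD)
  qed (use assms(1) in auto)
  have le: "(x, y) \<in> R \<longleftrightarrow> \<rho> x \<le> \<rho> y" if "x \<in> U" "y \<in> U" for x y
  proof (cases "x = y")
    case True
    then show ?thesis using that R(1) by (simp add: refl_on_def)
  next
    case False
    then have "(x, y) \<in> R \<or> (y, x) \<in> R" using that R(4) by (simp add: total_on_def)
    then show ?thesis using less[of x y] less[of y x] that False by (metis leD less_imp_le)
  qed
  have inj: "inj_on \<rho> U"
    using less R(4) by (auto simp: inj_on_def total_on_def) (metis less_irrefl)
  have "\<rho> x < card U" if "x \<in> U" for x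
    unfolding \<rho>_def using that assms(1) by (intro psubset_card_mono) auto
  then have "\<rho> ` U = {..<card U}"
    by (intro card_subset_eq) (auto simp: card_image[OF inj])
  then show thesis using that inj le by (simp add: bij_betw_def)
qed

lemma codes_exists:
  assumes A: "A \<in> ordered_F_class k"
  obtains a g \<rho> where "codes k A a g \<rho>"
proof -
  note A = ordered_F_classD[OF A]
  obtain \<rho> :: "'a \<Rightarrow> nat" where \<rho>: "bij_betw \<rho> (universe A) {..<card (universe A)}"
    and le: "\<And>x y. x \<in> universe A \<Longrightarrow> y \<in> universe A \<Longrightarrow> (x, y) \<in> le A \<longleftrightarrow> \<rho> x \<le> \<rho> y"
    using finite_linear_order_rank[OF A(1,2)] by blast
  define g where "g i j = \<rho> (fn A i (inv_into (universe A) \<rho> j))" for i j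
  have g: "\<rho> (fn A i x) = g i (\<rho> x)" if "x \<in> universe A" for i x
    using that \<rho> by (simp add: g_def bij_betw_inv_into_left)
  have "good_at {1..k} g (\<rho> x) \<and> (\<forall>i\<in>{1..k}. g i (\<rho> x) < card (universe A))" if "x \<in> universe A" for x
  proof
    show "good_at {1..k} g (\<rho> x)"
      by (rule good_at_transfer[where U = "universe A" and F = "fn A"])
         (use that A \<rho> g in \<open>auto simp: bij_betw_def\<close>)
    show "\<forall>i\<in>{1..k}. g i (\<rho> x) < card (universe A)"
      using that A(3) bij_betwE[OF \<rho>] by (auto simp flip: g)
  qed
  then have "pattern {1..k} (card (universe A)) g"
    using bij_betw_imp_surj_on[OF \<rho>] unfolding pattern_def by (metis imageE lessThan_iff)
  with \<rho> le g A(3) have "codes k A (card (universe A)) g \<rho>" by (simp add: codes_def)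
  then show thesis by (rule that)
qed

text \<open>Inside one part the order is arbitrary: all relevant copies are transversal to the parts.\<close>

definition realize :: "nat \<Rightarrow> (nat \<Rightarrow> 'v) \<Rightarrow> nat psys \<Rightarrow> 'v ordered_structure" where
  "realize k \<iota> Q = \<lparr>
     universe = \<iota> ` pts Q,
     fn = (\<lambda>i\<in>{1..k}. \<lambda>y\<in>\<iota> ` pts Q. \<iota> (act Q i (inv \<iota> y))),
     le = {(\<iota> x, \<iota> y) | x y. x \<in> pts Q \<and> y \<in> pts Q \<and>
       (proj Q x < proj Q y \<or> proj Q x = proj Q y \<and> x \<le> y)} \<rparr>"

lemma le_realize:
  "inj \<iota> \<Longrightarrow> (\<iota> x, \<iota> y) \<in> le (realize k \<iota> Q) \<longleftrightarrow> x \<in> pts Q \<and> y \<in> pts Q \<and>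
     (proj Q x < proj Q y \<or> proj Q x = proj Q y \<and> x \<le> y)"
  by (auto simp: realize_def inj_eq)

lemma realize_in_ordered_F_class:
  assumes Q: "partite {1..k} Q" and \<iota>: "inj \<iota>"
  shows "realize k \<iota> Q \<in> ordered_F_class k"
proof -
  let ?C = "realize k \<iota> Q"
  have act: "fn ?C i (\<iota> x) = \<iota> (act Q i x)" if "i \<in> {1..k}" "x \<in> pts Q" for i x
    using that \<iota> by (simp add: realize_def)
  have "good_at {1..k} (fn ?C) (\<iota> x)" if "x \<in> pts Q" for x
    by (rule good_at_transfer[where U = "pts Q" and F = "act Q"])
       (use that Q act in \<open>auto simp: partite_def intro: inj_on_subset[OF \<iota>]\<close>)
  moreover have "fn ?C \<in> {1..k} \<rightarrow>\<^sub>E (universe ?C \<rightarrow>\<^sub>E universe ?C)"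
    using Q \<iota> by (auto simp: realize_def partite_def)
  ultimately have "fun_structure.truncate ?C \<in> F_class k"
    using Q by (auto simp: F_class_iff fun_structure.truncate_def partite_def realize_def)
  moreover have "linear_order_on (universe ?C) (le ?C)"
    unfolding order_on_defs
  proof (intro conjI)
    have le: "le ?C \<subseteq> \<iota> ` pts Q \<times> \<iota> ` pts Q" by (auto simp: realize_def)
    have univ: "universe ?C = \<iota> ` pts Q" by (simp add: realize_def)
    show "le ?C \<subseteq> universe ?C \<times> universe ?C" using le univ by simp
    show "refl_on (universe ?C) (le ?C)"
      unfolding univ refl_on_def by (auto simp: le_realize[OF \<iota>])
    show "trans (le ?C)"
    proof (rule transI)
      fix x y z assume xyz: "(x, y) \<in> le ?C" "(y, z) \<in> le ?C"
      with le obtain x' y' z' where "x = \<iota> x'" "y = \<iota> y'" "z = \<iota> z'" by blast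
      with xyz show "(x, z) \<in> le ?C" by (auto simp: le_realize[OF \<iota>])
    qed
    show "antisym (le ?C)"
    proof (rule antisymI)
      fix x y assume xy: "(x, y) \<in> le ?C" "(y, x) \<in> le ?C"
      with le obtain x' y' where "x = \<iota> x'" "y = \<iota> y'" by blast
      with xy show "x = y" by (auto simp: le_realize[OF \<iota>])
    qed
    show "total_on (universe ?C) (le ?C)"
      unfolding univ total_on_def by (auto simp: le_realize[OF \<iota>])
  qed
  ultimately show ?thesis by (simp add: ordered_F_class_def)
qed

text \<open>As \<open>s\<close> is strictly increasing, the points of an occurrence lie in distinct
  parts and are ordered as these parts, hence as the points of \<open>A\<close>.\<close>

lemma embedding_realize:
  assumes A: "codes k A a g \<rho>" and \<iota>: "inj \<iota>"
    and s: "sorted_wrt (<) s" "length s = a" and xs: "xs \<in> occs {1..k} g Q s"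
  shows "embedding k A (realize k \<iota> Q) (\<lambda>v. \<iota> (xs ! \<rho> v))"
proof -
  have len: "length xs = a" using occs_length[OF xs] s by simp
  have \<rho>: "\<rho> v < a" if "v \<in> universe A" for v using A that by (auto simp: codes_def dest: bij_betwE)
  have proj: "proj Q (xs ! j) = s ! j" if "j < a" for j using xs that len by (auto simp: occs_def)
  have pts: "xs ! j \<in> pts Q" if "j < a" for j using xs that len by (auto simp: occs_def)
  have dist: "j = l" if "xs ! j = xs ! l" "j < a" "l < a" for j l
    using s proj[of j] proj[of l] that by (metis nth_eq_iff_index_eq strict_sorted_iff)
  have inj: "inj_on \<rho> (universe A)" using A by (auto simp: codes_def bij_betw_def)
  show ?thesis
    unfolding embedding_def
  proof (intro conjI ballI impI)
    show "(\<lambda>v. \<iota> (xs ! \<rho> v)) \<in> universe A \<rightarrow> universe (realize k \<iota> Q)"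
      using pts \<rho> by (auto simp: realize_def)
    show "inj_on (\<lambda>v. \<iota> (xs ! \<rho> v)) (universe A)"
      using dist \<rho> inj injD[OF \<iota>] unfolding inj_on_def by metis
  next
    fix x y assume x: "x \<in> universe A" and y: "y \<in> universe A" and "(x, y) \<in> le A"
    then have "\<rho> x \<le> \<rho> y" using A by (simp add: codes_def)
    then have "\<rho> x = \<rho> y \<or> s ! \<rho> x < s ! \<rho> y"
      using \<rho>[OF y] s by (auto simp: sorted_wrt_iff_nth_less le_less)
    then show "(\<iota> (xs ! \<rho> x), \<iota> (xs ! \<rho> y)) \<in> le (realize k \<iota> Q)"
      using proj pts \<rho>[OF x] \<rho>[OF y] by (auto simp: le_realize[OF \<iota>])
  next
    fix i x assume i: "i \<in> {1..k}" and x: "x \<in> universe A"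
    have "act Q i (xs ! \<rho> x) = xs ! \<rho> (fn A i x)"
      using A i x xs \<rho>[OF x] s(2) by (simp add: occs_def codes_def)
    then show "fn (realize k \<iota> Q) i (\<iota> (xs ! \<rho> x)) = \<iota> (xs ! \<rho> (fn A i x))"
      using i pts[OF \<rho>[OF x]] \<iota> by (simp add: realize_def)
  qed
qed

section \<open>Copies and the embeddings behind them\<close>

lemma image_structure_cong:
  assumes A: "A \<in> ordered_F_class k" and eq: "\<And>v. v \<in> universe A \<Longrightarrow> f v = f' v"
    and inj: "inj_on f (universe A)"
  shows "image_structure k f A = image_structure k f' A"
proof -
  note A = ordered_F_classD[OF A]
  have im: "f ` universe A = f' ` universe A" using eq by auto
  have inj': "inj_on f' (universe A)" using inj eq by (simp cong: inj_on_cong)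
  have fn: "(\<lambda>y\<in>f ` universe A. f (fn A i (inv_into (universe A) f y))) =
      (\<lambda>y\<in>f' ` universe A. f' (fn A i (inv_into (universe A) f' y)))" if "i \<in> {1..k}" for i
  proof (rule restrict_cong[OF im], unfold simp_implies_def)
    fix y assume "y \<in> f' ` universe A"
    then obtain v where v: "v \<in> universe A" "y = f' v" by blast
    then have "inv_into (universe A) f y = v" "inv_into (universe A) f' y = v"
      using inj inj' eq by (metis inv_into_f_f)+
    then show "f (fn A i (inv_into (universe A) f y)) = f' (fn A i (inv_into (universe A) f' y))"
      using A(3)[OF that v(1)] eq by simp
  qed
  have "map_prod f f ` le A = map_prod f' f' ` le A"
    using A(5) eq by (intro image_cong) auto
  moreover have "fn (image_structure k f A) = fn (image_structure k f' A)"
    unfolding image_structure_def using fn by (simp only: fun_structure.simps) (rule restrict_ext)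
  ultimately show ?thesis using im by (simp add: image_structure_def)
qed

text \<open>\<open>f\<close> is an isomorphism onto its image, so \<open>e\<close> factors through
  it: copies of \<open>A\<close> inside a copy of \<open>B\<close> come from embeddings into
  \<open>B\<close>.\<close>

lemma embedding_image_structure:
  assumes A: "A \<in> ordered_F_class k" and B: "B \<in> ordered_F_class k" and f: "inj_on f (universe B)"
    and e: "embedding k A (image_structure k f B) e"
  obtains d where "embedding k A B d" "\<And>v. v \<in> universe A \<Longrightarrow> e v = f (d v)"
proof -
  note A = ordered_F_classD[OF A] and B = ordered_F_classD[OF B]
  define d where "d = inv_into (universe B) f \<circ> e"
  have e_in: "e v \<in> f ` universe B" if "v \<in> universe A" for v
    using e that by (auto simp: embedding_def image_structure_def)
  have d: "d v \<in> universe B" "e v = f (d v)" if "v \<in> universe A" for v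
    using e_in[OF that] by (auto simp: d_def inv_into_into f_inv_into_f)
  have "embedding k A B d"
    unfolding embedding_def
  proof (intro conjI ballI impI)
    show "d \<in> universe A \<rightarrow> universe B" using d by auto
    show "inj_on d (universe A)"
      using e d(2) unfolding embedding_def inj_on_def by metis
  next
    fix x y assume x: "x \<in> universe A" and y: "y \<in> universe A" and "(x, y) \<in> le A"
    then have "(e x, e y) \<in> map_prod f f ` le B"
      using e by (simp add: embedding_def image_structure_def)
    then obtain u w where uw: "(u, w) \<in> le B" "f (d x) = f u" "f (d y) = f w"
      using d x y by auto
    then have "d x = u" "d y = w" using d[OF x] d[OF y] B(5) f by (auto simp: inj_on_def)
    with uw show "(d x, d y) \<in> le B" by simp
  next
    fix i x assume i: "i \<in> {1..k}" and x: "x \<in> universe A"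
    have "fn (image_structure k f B) i (e x) = e (fn A i x)"
      using e i x by (simp add: embedding_def)
    then have "f (fn B i (d x)) = f (d (fn A i x))"
      using i d[OF x] d(2)[OF A(3)[OF i x]] f by (simp add: image_structure_def)
    then show "fn B i (d x) = d (fn A i x)"
      using f B(3)[OF i d(1)[OF x]] d(1)[OF A(3)[OF i x]] by (simp add: inj_on_eq_iff)
  qed
  then show thesis using that d(2) by blast
qed

text \<open>Conjugation by the two rankings turns \<open>d\<close> into a list, strictly increasing
  since \<open>d\<close> is injective and preserves the order.\<close>

lemma embedding_sub_pattern:
  assumes A: "codes k A a g \<rho>" and B: "codes k B b g' \<sigma>" and d: "embedding k A B d"
  obtains p where "sub_pattern {1..k} a g b g' p"
    and "\<And>v. v \<in> universe A \<Longrightarrow> p ! \<rho> v = \<sigma> (d v)"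
proof -
  let ?\<alpha> = "inv_into (universe A) \<rho>"
  define p where "p = map (\<lambda>j. \<sigma> (d (?\<alpha> j))) [0..<a]"
  have \<rho>: "bij_betw \<rho> (universe A) {..<a}" and \<sigma>: "bij_betw \<sigma> (universe B) {..<b}"
    using A B by (auto simp: codes_def)
  have \<alpha>: "?\<alpha> j \<in> universe A" "\<rho> (?\<alpha> j) = j" if "j < a" for j
    using \<rho> that by (auto simp: bij_betw_def inv_into_into f_inv_into_f)
  have d_in: "d v \<in> universe B" if "v \<in> universe A" for v
    using d that by (auto simp: embedding_def)
  have p: "p ! \<rho> v = \<sigma> (d v)" if "v \<in> universe A" for v
    using that \<rho> bij_betwE[OF \<rho>] by (auto simp: p_def bij_betw_inv_into_left)
  have "p ! i < p ! j" if "i < j" "j < a" for i j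
  proof -
    have i: "i < a" using that by simp
    have "(?\<alpha> i, ?\<alpha> j) \<in> le A" using A that \<alpha>[OF i] \<alpha>[OF that(2)] by (simp add: codes_def)
    then have "(d (?\<alpha> i), d (?\<alpha> j)) \<in> le B" using d \<alpha>(1)[OF i] \<alpha>(1)[OF that(2)] by (simp add: embedding_def)
    then have "\<sigma> (d (?\<alpha> i)) \<le> \<sigma> (d (?\<alpha> j))"
      using B d_in[OF \<alpha>(1)[OF i]] d_in[OF \<alpha>(1)[OF that(2)]] by (simp add: codes_def)
    moreover have "\<sigma> (d (?\<alpha> i)) \<noteq> \<sigma> (d (?\<alpha> j))"
    proof
      assume "\<sigma> (d (?\<alpha> i)) = \<sigma> (d (?\<alpha> j))"
      then have "d (?\<alpha> i) = d (?\<alpha> j)"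
        using \<sigma> d_in[OF \<alpha>(1)[OF i]] d_in[OF \<alpha>(1)[OF that(2)]] by (auto simp: bij_betw_def inj_on_def)
      then have "?\<alpha> i = ?\<alpha> j"
        using d \<alpha>(1)[OF i] \<alpha>(1)[OF that(2)] by (auto simp: embedding_def inj_on_def)
      then show False using \<alpha>(2)[OF i] \<alpha>(2)[OF that(2)] that(1) by simp
    qed
    ultimately show ?thesis using that by (simp add: p_def)
  qed
  moreover have "set p \<subseteq> {..<b}"
    using bij_betwE[OF \<sigma>] d_in \<alpha>(1) by (auto simp: p_def)
  moreover have "g' i (p ! j) = p ! g i j" if "i \<in> {1..k}" "j < a" for i j
  proof -
    note v = \<alpha>[OF that(2)]
    have "g' i (p ! j) = \<sigma> (fn B i (d (?\<alpha> j)))"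
      using p[OF v(1)] v(2) B that(1) d_in[OF v(1)] by (simp add: codes_def)
    also have "\<dots> = \<sigma> (d (fn A i (?\<alpha> j)))" using d that(1) v(1) by (simp add: embedding_def)
    also have "\<dots> = p ! g i j"
    proof -
      have "\<rho> (fn A i (?\<alpha> j)) = g i j" using A v that(1) by (simp add: codes_def)
      moreover have "g i j < a" using A that by (simp add: codes_def pattern_def)
      moreover have "fn A i (?\<alpha> j) \<in> universe A" using A v(1) that(1) by (simp add: codes_def)
      ultimately show ?thesis using p by metis
    qed
    finally show ?thesis .
  qed
  ultimately have "sub_pattern {1..k} a g b g' p"
    by (simp add: sub_pattern_def p_def sorted_wrt_iff_nth_less)
  with p show thesis by (rule that[rotated -1]) 
qed

section \<open>The Ramsey property of the class\<close>

theorem theorem6p2: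
  fixes k :: nat
  assumes "k > 0"
  shows "ramsey_class (copies k) (ordered_F_class k :: 'v::infinite ordered_structure set)"
  unfolding ramsey_class_def
proof (intro ballI allI impI)
  fix A B :: "'v ordered_structure" and r :: nat
  assume A: "A \<in> ordered_F_class k" and B: "B \<in> ordered_F_class k" and r: "0 < r"
  obtain a g \<rho> where cA: "codes k A a g \<rho>" using codes_exists[OF A] .
  obtain b g' \<sigma> where cB: "codes k B b g' \<sigma>" using codes_exists[OF B] .
  have pat: "pattern {1..k} a g" "pattern {1..k} b g'" using cA cB by (auto simp: codes_def)
  obtain Q :: "nat psys" where Q: "partite {1..k} Q" and ram:
    "\<And>c. (\<And>s. sorted_wrt (<) s \<Longrightarrow> length s = a \<Longrightarrow> c \<in> occs {1..k} g Q s \<rightarrow> {..<r}) \<Longrightarrow>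
      \<exists>q<r. \<exists>t zs. sorted_wrt (<) t \<and> length t = b \<and> zs \<in> occs {1..k} g' Q t \<and>
        (\<forall>p. sub_pattern {1..k} a g b g' p \<longrightarrow> c (map ((!) zs) p) = q)"
    using partite_ramsey[OF pat r] by blast
  \<comment> \<open>The infinite type has room for every finite system on the naturals.\<close>
  obtain \<iota> :: "nat \<Rightarrow> 'v" where \<iota>: "inj \<iota>"
    using infinite_countable_subset[OF infinite_UNIV] by blast
  define C where "C = realize k \<iota> Q"
  define cp where "cp xs = image_structure k (\<lambda>v. \<iota> (xs ! \<rho> v)) A" for xs
  have C: "C \<in> ordered_F_class k" unfolding C_def by (rule realize_in_ordered_F_class[OF Q \<iota>])
  show "\<exists>C\<in>ordered_F_class k :: 'v ordered_structure set. \<forall>P. disjoint_family_on P {..<r} \<and> (\<Union>i<r. P i) = copies k C A \<longrightarrow>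
      (\<exists>B'\<in>copies k C B. \<exists>i<r. copies k B' A \<subseteq> P i)"
  proof (rule bexI[OF _ C], intro allI impI)
    fix P :: "nat \<Rightarrow> 'v ordered_structure set"
    assume "disjoint_family_on P {..<r} \<and> (\<Union>i<r. P i) = copies k C A"
    then have P: "(\<Union>i<r. P i) = copies k C A" by simp
    \<comment> \<open>The partition of the copies becomes a colouring of lists: an occurrence gets
      the index of the class of its copy.\<close>
    define c where "c xs = (LEAST i. i < r \<and> cp xs \<in> P i)" for xs
    have c: "c xs < r \<and> cp xs \<in> P (c xs)"
      if "sorted_wrt (<) s" "length s = a" "xs \<in> occs {1..k} g Q s" for s xs
    proof -
      have "cp xs \<in> copies k C A"
        unfolding copies_def cp_def C_def using embedding_realize[OF cA \<iota> that] by blast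
      then have "\<exists>i. i < r \<and> cp xs \<in> P i" using P by blast
      then show ?thesis unfolding c_def by (rule LeastI_ex)
    qed
    then obtain q t zs where q: "q < r" and t: "sorted_wrt (<) t" "length t = b"
      and zs: "zs \<in> occs {1..k} g' Q t"
      and mono: "\<And>p. sub_pattern {1..k} a g b g' p \<Longrightarrow> c (map ((!) zs) p) = q"
      using ram[of c] by blast
    define f where "f v = \<iota> (zs ! \<sigma> v)" for v
    have f: "embedding k B C f"
      unfolding f_def C_def by (rule embedding_realize[OF cB \<iota> t zs])
    have "copies k (image_structure k f B) A \<subseteq> P q"
    proof
      fix X assume "X \<in> copies k (image_structure k f B) A"
      then obtain e where e: "embedding k A (image_structure k f B) e" and X: "X = image_structure k e A"
        by (auto simp: copies_def)
      have "inj_on f (universe B)" using f by (simp add: embedding_def)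
      from embedding_image_structure[OF A B this e] obtain d where d: "embedding k A B d"
        and ed: "\<And>v. v \<in> universe A \<Longrightarrow> e v = f (d v)" by blast
      obtain p where p: "sub_pattern {1..k} a g b g' p"
        and pd: "\<And>v. v \<in> universe A \<Longrightarrow> p ! \<rho> v = \<sigma> (d v)"
        using embedding_sub_pattern[OF cA cB d] by blast
      have "map ((!) zs) p \<in> occs {1..k} g Q (map ((!) t) p)"
        by (rule occs_sub_pattern[OF p pat(1) zs t(2)])
      moreover have "sorted_wrt (<) (map ((!) t) p)" "length (map ((!) t) p) = a"
        using p sorted_sub_pattern[OF p t] by (simp_all add: sub_pattern_def)
      ultimately have "cp (map ((!) zs) p) \<in> P q" using c mono[OF p] by metis
      \<comment> \<open>\<open>e\<close> agrees on \<open>A\<close> with the embedding read off from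
        this occurrence, so both have the same image structure.\<close>
      moreover have "X = cp (map ((!) zs) p)"
        unfolding X cp_def
      proof (rule image_structure_cong[OF A])
        show "inj_on e (universe A)" using e by (simp add: embedding_def)
        fix v assume v: "v \<in> universe A"
        then have "\<rho> v < length p" using cA p by (auto simp: codes_def sub_pattern_def dest: bij_betwE)
        then show "e v = \<iota> (map ((!) zs) p ! \<rho> v)" using ed pd v by (simp add: f_def)
      qed
      ultimately show "X \<in> P q" by simp
    qed
    moreover have "image_structure k f B \<in> copies k C B" using f by (auto simp: copies_def)
    ultimately show "\<exists>B'\<in>copies k C B. \<exists>i<r. copies k B' A \<subseteq> P i" using q by blast
  qed
qed

end
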